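(* There are no synchronisation patterns $\star$ in $\mathrm{CMV}^+$; that is, no process in $\mathcal P_{\mathrm{CMV}^+}$ is a $\star$.
   Context: **The calculus $\mathrm{CMV}^+$ (mixed sessions).** Names range over a countably infinite set. Untyped processes: $P::=q\,y\sum_{i\in I}M_i\mid P\mid P\mid(\nu yz)P\mid\mathsf{if}\ v\ \mathsf{then}\ P\ \mathsf{else}\ P\mid\mathbf 0$; branches $M::=l*v.P$ with label $l$, polarity $*\in\{!,?\}$; qualifiers $q\in\{\mathsf{lin},\mathsf{un}\}$; values $v::=x\mid\mathsf{true}\mid\mathsf{false}\mid()$ (in an input branch $l?x.P$ the variable $x$ is bound in $P$). $(\nu yz)P$ binds the two endpoints $y,z$ of one channel. The empty choice is $\mathbf 0$. $\equiv$ is the least congruence containing $\alpha$-conversion with the commutative monoid laws for $\mid,\mathbf 0$; $(\nu yz)\mathbf 0\equiv\mathbf 0$; $P\mid(\nu yz)Q\equiv(\nu yz)(P\mid Q)$ if $y,z\notin\mathrm{fn}(P)$; $(\nu yz)P\equiv(\nu zy)P$; $(\nu wx)(\nu yz)P\equiv(\nu yz)(\nu wx)P$. Reduction: $\mathsf{if}\ \mathsf{true}\ \mathsf{then}\ P\ \mathsf{else}\ Q\longmapsto P$; $\mathsf{if}\ \mathsf{false}\ \mathsf{then}\ P\ \mathsf{else}\ Q\longmapsto Q$; for $q_1,q_2\in\{\mathsf{lin},\mathsf{un}\}$, with $C_1=q_1\,y(l!v.P+M)$ and $C_2=q_2\,z(l?x.Q+N)$: $(\nu yz)(C_1\mid C_2\mid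 R)\longmapsto(\nu yz)(P\mid Q\{v/x\}\mid C_1'\mid C_2'\mid R)$, where $C_i'=C_i$ if $q_i=\mathsf{un}$ and $C_i'$ is absent if $q_i=\mathsf{lin}$ (this step *reduces* the choices $C_1$ and $C_2$); closed under $\mid$, $(\nu yz)$ and $\equiv$. *Typing of $\mathrm{CMV}^+$.* Types $T::=q\#\{l_i*_iT_i.U_i\}_{i\in I}\mid\mathsf{end}\mid\mathsf{unit}\mid\mathsf{bool}\mid\mu t.T\mid t$ with view $\#\in\{\oplus,\&\}$ (internal/external), $I\neq\emptyset$, label-polarity pairs $l_i*_i$ pairwise distinct, recursion contractive. Type equivalence $\simeq$ is the coinductive congruence identifying $\mu t.T$ with its unfolding. Duality $T\perp U$ (coinductive, up to unfolding): $\mathsf{end}\perp\mathsf{end}$; $q\#\{l_i*_iT_i.U_i\}_{i\in I}\perp q\flat\{l_i\bullet_iT_i'.U_i'\}_{i\in I}$ if $\#,\flat$ are opposite views, $*_i,\bullet_i$ opposite polarities, $T_i\simeq T_i'$, $U_i\perp U_i'$. Subtyping $<:$ (coinductive, up to unfolding): reflexive on $\mathsf{end},\mathsf{unit},\mathsf{bool}$; $l!T_1.U_1<:l!T_2.U_2$ if $T_2<:T_1,U_1<:U_2$; $l?T_1.U_1<:l?T_2.U_2$ if $T_1<:T_2,U_1<:U_2$; $q\oplus\{B_i\}_{i\in I}<:q\oplus\{C_j\}_{j\in J}$ if $J\subseteq I$ and $B_j<:C_j$ for $j\in J$; $q\&\{B_i\}_{i\in I}<:q\&\{C_j\}_{j\in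 J}$ if $I\subseteq J$ and $B_i<:C_i$ for $i\in I$. $\mathsf{un}(T)$ holds for $\mathsf{end},\mathsf{unit},\mathsf{bool}$, choice types qualified $\mathsf{un}$, and $\mu t.T$ with $\mathsf{un}(T)$; $\mathsf{un}(\Gamma)$ if all types in $\Gamma$ are so; every context satisfies $\mathsf{lin}(\Gamma)$. Context split $\Gamma_1\circ\Gamma_2$: assignments with unrestricted types are shared by both parts, those with linear types go to exactly one part. $\Gamma+x{:}T=\Gamma,x{:}T$ if $x$ is not assigned in $\Gamma$, and $(\Gamma,x{:}T)+x{:}T=\Gamma,x{:}T$ if $\mathsf{un}(T)$. Rules: under $\mathsf{un}(\Gamma)$: $\Gamma\vdash():\mathsf{unit}$, $\Gamma\vdash\mathsf{true},\mathsf{false}:\mathsf{bool}$, $\Gamma\vdash\mathbf 0$; $\Gamma_1,x{:}T,\Gamma_2\vdash x:T$ if $\mathsf{un}(\Gamma_1,\Gamma_2)$; subsumption $\Gamma\vdash v:T$, $T<:U$ gives $\Gamma\vdash v:U$; $\Gamma_1\vdash v:T$, $\Gamma_2\vdash P$ give $\Gamma_1\circ\Gamma_2\vdash l!v.P:l!T.U$; $\Gamma,x{:}T\vdash P$ gives $\Gamma\vdash l?x.P:l?T.U$; $\Gamma_i\vdash P_i$ give $\Gamma_1\circ\Gamma_2\vdash P_1\mid P_2$; $\Gamma_1\vdash v:\mathsf{bool}$, $\Gamma_2\vdash P$, $\Gamma_2\vdash Q$ give $\Gamma_1\circ\Gamma_2\vdash\mathsf{if}\ v\ \mathsf{then}\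 P\ \mathsf{else}\ Q$; $\Gamma,x{:}T,y{:}U\vdash P$, $T\perp U$ give $\Gamma\vdash(\nu xy)P$; and if $q_1(\Gamma_1\circ\Gamma_2)$, $\Gamma_1\vdash x:q_2\#\{l_i*_iT_i.U_i\}_{i\in I}$, the set of label-polarity pairs of the branches $j\in J$ equals that of the type, and for every $j\in J$ (with $T_j,U_j$ taken from the type branch having the same label-polarity pair) $\Gamma_2+x{:}U_j\vdash l_j*_jv_j.P_j:l_j*_jT_j.U_j$, then $\Gamma_1\circ\Gamma_2\vdash q_1\,x\sum_{j\in J}l_j*_jv_j.P_j$. $\mathcal P_{\mathrm{CMV}^+}$ is the set of processes $P$ with $\Gamma\vdash P$ for some $\Gamma$. **Conflict and distributability of steps.** Two different steps that a single process $P\in\mathcal P_{\mathrm{CMV}^+}$ can perform are called alternative. Two alternative steps of $P$ are *in conflict* if they reduce the same (occurrence of a) choice, not necessarily the same summand of it, or the same conditional; otherwise they are *distributable*. **Synchronisation pattern $\star$.** A process $P^\star$ is a $\star$ if: (i) $P^\star$ can perform at least five alternative reduction steps $i:P^\star\longmapsto P_i$ for $i\in\{a,b,c,d,e\}$ such that the $P_i$ are pairwise different; (ii) $a$ is in conflict with $b$, $b$ with $c$, $c$ with $d$, $d$ with $e$, and $e$ with $a$; (iii) every pair of steps in $\{a,b,c,d,e\}$ that is not in conflict due to (ii) is distributable in $P^\star$. *)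

theory Defs
  imports "HOL-Library.Multiset" "HOL-Library.Finite_Map" "HOL-Combinatorics.Transposition"
begin

section \<open>Processes\<close>

type_synonym name = nat
type_synonym label = nat

datatype pol = Snd | Rcv    \<comment> \<open>the polarities \<open>!\<close> and \<open>?\<close>\<close>
datatype qual = Lin | Unr

datatype 'n val = Name 'n | VTrue | VFalse | VUnit

text \<open>
  Every choice and every conditional carries an annotation of type \<open>'t\<close>. The processes of the
  calculus are those with annotations in \<open>unit\<close>. Annotating a process with pairwise different
  annotations makes the occurrences of choices and conditionals identifiable, and structural
  congruence and reduction carry the annotations along.

  The inert process is \<open>Inert\<close>, and this is also how the empty choice is written. The raw
  terms \<open>Choice t q y {#}\<close> and \<open>Res y y P\<close> (equal endpoints) do not stand for processes:
  they are not typable, and structural congruence does not introduce them.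
\<close>

datatype ('n, 't) proc =
    Choice 't qual 'n "('n, 't) branch multiset"
  | Par "('n, 't) proc" "('n, 't) proc"
  | Res 'n 'n "('n, 't) proc"
  | If 't "'n val" "('n, 't) proc" "('n, 't) proc"
  | Inert
and ('n, 't) branch =
    Out label "'n val" "('n, 't) proc"
  | In label 'n "('n, 't) proc"

type_synonym 't aproc = "(name, 't) proc"
type_synonym 't abranch = "(name, 't) branch"
type_synonym process = "unit aproc"

abbreviation erase :: "'t aproc \<Rightarrow> process" where
  "erase \<equiv> map_proc id (\<lambda>_. ())"

fun branch_key :: "('n, 't) branch \<Rightarrow> label \<times> pol" where
  "branch_key (Out l v P) = (l, Snd)"
| "branch_key (In l x P) = (l, Rcv)"

primrec occs :: "('n, 't) proc \<Rightarrow> 't multiset" and occs_br :: "('n, 't) branch \<Rightarrow> 't multiset" where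
  "occs (Choice t q y Ms) = add_mset t (\<Sum>\<^sub># (image_mset occs_br Ms))"
| "occs (Par P Q) = occs P + occs Q"
| "occs (Res y z P) = occs P"
| "occs (If t v P Q) = add_mset t (occs P + occs Q)"
| "occs Inert = {#}"
| "occs_br (Out l v P) = occs P"
| "occs_br (In l x P) = occs P"

primrec fn_val :: "'n val \<Rightarrow> 'n set" where
  "fn_val (Name x) = {x}"
| "fn_val VTrue = {}"
| "fn_val VFalse = {}"
| "fn_val VUnit = {}"

primrec fn :: "('n, 't) proc \<Rightarrow> 'n set" and fn_br :: "('n, 't) branch \<Rightarrow> 'n set" where
  "fn (Choice t q y Ms) = insert y (\<Union> (set_mset (image_mset fn_br Ms)))"
| "fn (Par P Q) = fn P \<union> fn Q"
| "fn (Res y z P) = fn P - {y, z}"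
| "fn (If t v P Q) = fn_val v \<union> fn P \<union> fn Q"
| "fn Inert = {}"
| "fn_br (Out l v P) = fn_val v \<union> fn P"
| "fn_br (In l x P) = fn P - {x}"

text \<open>Transposition of two names in a process, at free, bound and binding positions alike.\<close>

abbreviation swap :: "name \<Rightarrow> name \<Rightarrow> 't aproc \<Rightarrow> 't aproc" where
  "swap x y \<equiv> map_proc (transpose x y) id"

text \<open>
  \<open>subst v x P\<close> replaces the free occurrences of \<open>x\<close> in \<open>P\<close> by \<open>v\<close> without renaming binders. It
  is the substitution \<open>P{v/x}\<close> only if \<open>subst_ok v x P\<close>: no binder of \<open>P\<close> captures \<open>v\<close>,
  and a value that is not a name is not put in the subject position of a choice. The first
  condition can always be met by \<open>\<alpha>\<close>-conversion.
\<close>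

primrec subst_val :: "name val \<Rightarrow> name \<Rightarrow> name val \<Rightarrow> name val" where
  "subst_val v x (Name y) = (if y = x then v else Name y)"
| "subst_val v x VTrue = VTrue"
| "subst_val v x VFalse = VFalse"
| "subst_val v x VUnit = VUnit"

primrec subst_subj :: "name val \<Rightarrow> name \<Rightarrow> name" where
  "subst_subj (Name u) y = u"
| "subst_subj VTrue y = y"
| "subst_subj VFalse y = y"
| "subst_subj VUnit y = y"

primrec subst :: "name val \<Rightarrow> name \<Rightarrow> 't aproc \<Rightarrow> 't aproc"
  and subst_br :: "name val \<Rightarrow> name \<Rightarrow> 't abranch \<Rightarrow> 't abranch" where
  "subst v x (Choice t q y Ms) =
     Choice t q (if y = x then subst_subj v y else y) (image_mset (subst_br v x) Ms)"
| "subst v x (Par P Q) = Par (subst v x P) (subst v x Q)"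
| "subst v x (Res y z P) = Res y z (if x \<in> {y, z} then P else subst v x P)"
| "subst v x (If t w P Q) = If t (subst_val v x w) (subst v x P) (subst v x Q)"
| "subst v x Inert = Inert"
| "subst_br v x (Out l w P) = Out l (subst_val v x w) (subst v x P)"
| "subst_br v x (In l y P) = In l y (if x = y then P else subst v x P)"

primrec subst_ok :: "name val \<Rightarrow> name \<Rightarrow> 't aproc \<Rightarrow> bool"
  and subst_ok_br :: "name val \<Rightarrow> name \<Rightarrow> 't abranch \<Rightarrow> bool" where
  "subst_ok v x (Choice t q y Ms) \<longleftrightarrow>
     (y = x \<longrightarrow> (\<exists>u. v = Name u)) \<and> (\<forall>ok \<in># image_mset (subst_ok_br v x) Ms. ok)"
| "subst_ok v x (Par P Q) \<longleftrightarrow> subst_ok v x P \<and> subst_ok v x Q"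
| "subst_ok v x (Res y z P) \<longleftrightarrow>
     (x \<in> fn P - {y, z} \<longrightarrow> fn_val v \<inter> {y, z} = {} \<and> subst_ok v x P)"
| "subst_ok v x (If t w P Q) \<longleftrightarrow> subst_ok v x P \<and> subst_ok v x Q"
| "subst_ok v x Inert \<longleftrightarrow> True"
| "subst_ok_br v x (Out l w P) \<longleftrightarrow> subst_ok v x P"
| "subst_ok_br v x (In l y P) \<longleftrightarrow> (x \<in> fn P - {y} \<longrightarrow> y \<notin> fn_val v \<and> subst_ok v x P)"


section \<open>Alpha-conversion, structural congruence and reduction\<close>

text \<open>The least congruence containing \<open>R\<close>.\<close>

inductive congr :: "('t aproc \<Rightarrow> 't aproc \<Rightarrow> bool) \<Rightarrow> 't aproc \<Rightarrow> 't aproc \<Rightarrow> bool"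
  for R :: "'t aproc \<Rightarrow> 't aproc \<Rightarrow> bool" where
  base: "R P Q \<Longrightarrow> congr R P Q"
| refl: "congr R P P"
| sym: "congr R P Q \<Longrightarrow> congr R Q P"
| trans: "congr R P Q \<Longrightarrow> congr R Q S \<Longrightarrow> congr R P S"
| par: "congr R P P' \<Longrightarrow> congr R Q Q' \<Longrightarrow> congr R (Par P Q) (Par P' Q')"
| res: "congr R P P' \<Longrightarrow> congr R (Res y z P) (Res y z P')"
| cond: "congr R P P' \<Longrightarrow> congr R Q Q' \<Longrightarrow> congr R (If t v P Q) (If t v P' Q')"
| outp: "congr R P P' \<Longrightarrow>
    congr R (Choice t q y (add_mset (Out l v P) M)) (Choice t q y (add_mset (Out l v P') M))"
| inp: "congr R P P' \<Longrightarrow>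
    congr R (Choice t q y (add_mset (In l x P) M)) (Choice t q y (add_mset (In l x P') M))"

inductive alpha_ax :: "'t aproc \<Rightarrow> 't aproc \<Rightarrow> bool" where
  alpha_in: "x' \<notin> fn P \<Longrightarrow>
    alpha_ax (Choice t q y (add_mset (In l x P) M))
             (Choice t q y (add_mset (In l x' (swap x x' P)) M))"
| alpha_res1: "y \<noteq> z \<Longrightarrow> y' \<noteq> z \<Longrightarrow> y' \<notin> fn P \<Longrightarrow> alpha_ax (Res y z P) (Res y' z (swap y y' P))"
| alpha_res2: "y \<noteq> z \<Longrightarrow> z' \<noteq> y \<Longrightarrow> z' \<notin> fn P \<Longrightarrow> alpha_ax (Res y z P) (Res y z' (swap z z' P))"

text \<open>
  The side condition of \<open>res_res\<close> is implicit when bound names are assumed to be pairwise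
  different. Without it, a binder could move into the scope of a binder of the same name.
\<close>

inductive struct_ax :: "'t aproc \<Rightarrow> 't aproc \<Rightarrow> bool" where
  par_inert: "struct_ax (Par P Inert) P"
| par_comm: "struct_ax (Par P Q) (Par Q P)"
| par_assoc: "struct_ax (Par (Par P Q) R) (Par P (Par Q R))"
| res_inert: "y \<noteq> z \<Longrightarrow> struct_ax (Res y z Inert) Inert"
| scope: "y \<notin> fn P \<Longrightarrow> z \<notin> fn P \<Longrightarrow> struct_ax (Par P (Res y z Q)) (Res y z (Par P Q))"
| res_swap: "struct_ax (Res y z P) (Res z y P)"
| res_res: "{w, x} \<inter> {y, z} = {} \<Longrightarrow> struct_ax (Res w x (Res y z P)) (Res y z (Res w x P))"

definition alpha :: "'t aproc \<Rightarrow> 't aproc \<Rightarrow> bool" where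
  "alpha = congr alpha_ax"

definition scong :: "'t aproc \<Rightarrow> 't aproc \<Rightarrow> bool" where
  "scong = congr (\<lambda>P Q. alpha_ax P Q \<or> struct_ax P Q)"

text \<open>
  \<open>red P ts P'\<close> is a reduction step from \<open>P\<close> to \<open>P'\<close> that reduces the choices and conditionals
  with the annotations in \<open>ts\<close>.
\<close>

inductive red :: "'t aproc \<Rightarrow> 't set \<Rightarrow> 't aproc \<Rightarrow> bool" where
  if_true: "red (If t VTrue P Q) {t} P"
| if_false: "red (If t VFalse P Q) {t} Q"
| comm: "C\<^sub>1 = Choice t\<^sub>1 q\<^sub>1 y (add_mset (Out l v P) M) \<Longrightarrow>
    C\<^sub>2 = Choice t\<^sub>2 q\<^sub>2 z (add_mset (In l x Q) N) \<Longrightarrow>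
    subst_ok v x Q \<Longrightarrow>
    red (Res y z (Par C\<^sub>1 (Par C\<^sub>2 R))) {t\<^sub>1, t\<^sub>2}
        (Res y z (Par P (Par (subst v x Q)
          (Par (if q\<^sub>1 = Unr then C\<^sub>1 else Inert) (Par (if q\<^sub>2 = Unr then C\<^sub>2 else Inert) R)))))"
| red_par: "red P ts P' \<Longrightarrow> red (Par P Q) ts (Par P' Q)"
| red_res: "red P ts P' \<Longrightarrow> red (Res y z P) ts (Res y z P')"
| red_scong: "scong P Q \<Longrightarrow> red Q ts Q' \<Longrightarrow> scong Q' P' \<Longrightarrow> red P ts P'"


section \<open>Types\<close>

datatype view = Internal | External

text \<open>
  The branches of a choice type form a finite map from label-polarity pairs to pairs of a payload
  and a continuation type, so that the label-polarity pairs are pairwise distinct.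
\<close>

datatype ty =
    TChoice qual view "(label \<times> pol, ty \<times> ty) fmap"
  | End
  | TUnit
  | TBool
  | Mu nat ty
  | TVar nat

fun dual_pol :: "pol \<Rightarrow> pol" where
  "dual_pol Snd = Rcv"
| "dual_pol Rcv = Snd"

fun dual_view :: "view \<Rightarrow> view" where
  "dual_view Internal = External"
| "dual_view External = Internal"

text \<open>Only applied to closed \<open>S\<close>, so that no binder of \<open>T\<close> can capture.\<close>

primrec tsubst :: "nat \<Rightarrow> ty \<Rightarrow> ty \<Rightarrow> ty" where
  "tsubst t S (TChoice q w B) = TChoice q w (fmmap (map_prod (tsubst t S) (tsubst t S)) B)"
| "tsubst t S End = End"
| "tsubst t S TUnit = TUnit"
| "tsubst t S TBool = TBool"
| "tsubst t S (Mu s T) = Mu s (if s = t then T else tsubst t S T)"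
| "tsubst t S (TVar s) = (if s = t then S else TVar s)"

text \<open>\<open>T\<close> is not the variable \<open>t\<close> under a possibly empty sequence of \<open>\<mu>\<close>-binders other than \<open>t\<close>.\<close>

primrec guarded :: "nat \<Rightarrow> ty \<Rightarrow> bool" where
  "guarded t (TChoice q w B) \<longleftrightarrow> True"
| "guarded t End \<longleftrightarrow> True"
| "guarded t TUnit \<longleftrightarrow> True"
| "guarded t TBool \<longleftrightarrow> True"
| "guarded t (Mu s T) \<longleftrightarrow> s = t \<or> guarded t T"
| "guarded t (TVar s) \<longleftrightarrow> s \<noteq> t"

text \<open>
  \<open>wf_ty \<Delta> T\<close>: the free variables of \<open>T\<close> are in \<open>\<Delta>\<close>, recursion is contractive, and no choice type
  is empty. The types of the system are the \<open>T\<close> with \<open>wf_ty {} T\<close>.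
\<close>

inductive wf_ty :: "nat set \<Rightarrow> ty \<Rightarrow> bool" where
  "B \<noteq> fmempty \<Longrightarrow> (\<And>k T U. fmlookup B k = Some (T, U) \<Longrightarrow> wf_ty \<Delta> T \<and> wf_ty \<Delta> U) \<Longrightarrow>
    wf_ty \<Delta> (TChoice q w B)"
| "wf_ty \<Delta> End"
| "wf_ty \<Delta> TUnit"
| "wf_ty \<Delta> TBool"
| "guarded t T \<Longrightarrow> wf_ty (insert t \<Delta>) T \<Longrightarrow> wf_ty \<Delta> (Mu t T)"
| "t \<in> \<Delta> \<Longrightarrow> wf_ty \<Delta> (TVar t)"

text \<open>\<open>unfolds T H\<close>: unfolding the top-level recursion of \<open>T\<close> yields \<open>H\<close>, which is not a \<open>\<mu>\<close>-type.\<close>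

inductive unfolds :: "ty \<Rightarrow> ty \<Rightarrow> bool" where
  "(\<And>t S. H \<noteq> Mu t S) \<Longrightarrow> unfolds H H"
| "unfolds (tsubst t (Mu t T) T) H \<Longrightarrow> unfolds (Mu t T) H"

coinductive ty_equiv :: "ty \<Rightarrow> ty \<Rightarrow> bool" where
  "unfolds T H \<Longrightarrow> unfolds U H \<Longrightarrow> H \<in> {End, TUnit, TBool} \<Longrightarrow> ty_equiv T U"
| "unfolds T (TChoice q w B) \<Longrightarrow> unfolds U (TChoice q w C) \<Longrightarrow>
    fmdom' B = fmdom' C \<Longrightarrow>
    (\<And>k T\<^sub>1 U\<^sub>1 T\<^sub>2 U\<^sub>2. fmlookup B k = Some (T\<^sub>1, U\<^sub>1) \<Longrightarrow> fmlookup C k = Some (T\<^sub>2, U\<^sub>2) \<Longrightarrow>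
       ty_equiv T\<^sub>1 T\<^sub>2 \<and> ty_equiv U\<^sub>1 U\<^sub>2) \<Longrightarrow>
    ty_equiv T U"

coinductive dual :: "ty \<Rightarrow> ty \<Rightarrow> bool" where
  "unfolds T End \<Longrightarrow> unfolds U End \<Longrightarrow> dual T U"
| "unfolds T (TChoice q w B) \<Longrightarrow> unfolds U (TChoice q (dual_view w) C) \<Longrightarrow>
    fmdom' C = (\<lambda>(l, p). (l, dual_pol p)) ` fmdom' B \<Longrightarrow>
    (\<And>l p T\<^sub>1 U\<^sub>1 T\<^sub>2 U\<^sub>2. fmlookup B (l, p) = Some (T\<^sub>1, U\<^sub>1) \<Longrightarrow>
       fmlookup C (l, dual_pol p) = Some (T\<^sub>2, U\<^sub>2) \<Longrightarrow> ty_equiv T\<^sub>1 T\<^sub>2 \<and> dual U\<^sub>1 U\<^sub>2) \<Longrightarrow>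
    dual T U"

coinductive subty :: "ty \<Rightarrow> ty \<Rightarrow> bool" where
  "unfolds T H \<Longrightarrow> unfolds U H \<Longrightarrow> H \<in> {End, TUnit, TBool} \<Longrightarrow> subty T U"
| "unfolds T (TChoice q w B) \<Longrightarrow> unfolds U (TChoice q w C) \<Longrightarrow>
    (case w of Internal \<Rightarrow> fmdom' C \<subseteq> fmdom' B | External \<Rightarrow> fmdom' B \<subseteq> fmdom' C) \<Longrightarrow>
    (\<And>l T\<^sub>1 U\<^sub>1 T\<^sub>2 U\<^sub>2. fmlookup B (l, Snd) = Some (T\<^sub>1, U\<^sub>1) \<Longrightarrow> fmlookup C (l, Snd) = Some (T\<^sub>2, U\<^sub>2) \<Longrightarrow>
       subty T\<^sub>2 T\<^sub>1 \<and> subty U\<^sub>1 U\<^sub>2) \<Longrightarrow>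
    (\<And>l T\<^sub>1 U\<^sub>1 T\<^sub>2 U\<^sub>2. fmlookup B (l, Rcv) = Some (T\<^sub>1, U\<^sub>1) \<Longrightarrow> fmlookup C (l, Rcv) = Some (T\<^sub>2, U\<^sub>2) \<Longrightarrow>
       subty T\<^sub>1 T\<^sub>2 \<and> subty U\<^sub>1 U\<^sub>2) \<Longrightarrow>
    subty T U"

primrec un :: "ty \<Rightarrow> bool" where
  "un (TChoice q w B) \<longleftrightarrow> q = Unr"
| "un End \<longleftrightarrow> True"
| "un TUnit \<longleftrightarrow> True"
| "un TBool \<longleftrightarrow> True"
| "un (Mu t T) \<longleftrightarrow> un T"
| "un (TVar t) \<longleftrightarrow> False"


section \<open>Typing\<close>

type_synonym ctx = "(name, ty) fmap"

definition wf_ctx :: "ctx \<Rightarrow> bool" where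
  "wf_ctx \<Gamma> \<longleftrightarrow> (\<forall>x T. fmlookup \<Gamma> x = Some T \<longrightarrow> wf_ty {} T)"

primrec qual_ctx :: "qual \<Rightarrow> ctx \<Rightarrow> bool" where
  "qual_ctx Lin \<Gamma> \<longleftrightarrow> True"
| "qual_ctx Unr \<Gamma> \<longleftrightarrow> (\<forall>x T. fmlookup \<Gamma> x = Some T \<longrightarrow> un T)"

text \<open>\<open>\<Gamma> = \<Gamma>\<^sub>1 \<circ> \<Gamma>\<^sub>2\<close>; the linear types are those that are not unrestricted.\<close>

definition split :: "ctx \<Rightarrow> ctx \<Rightarrow> ctx \<Rightarrow> bool" where
  "split \<Gamma> \<Gamma>\<^sub>1 \<Gamma>\<^sub>2 \<longleftrightarrow> (\<forall>x. case fmlookup \<Gamma> x of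
      None \<Rightarrow> fmlookup \<Gamma>\<^sub>1 x = None \<and> fmlookup \<Gamma>\<^sub>2 x = None
    | Some T \<Rightarrow>
        if un T then fmlookup \<Gamma>\<^sub>1 x = Some T \<and> fmlookup \<Gamma>\<^sub>2 x = Some T
        else (fmlookup \<Gamma>\<^sub>1 x = Some T \<and> fmlookup \<Gamma>\<^sub>2 x = None) \<or>
             (fmlookup \<Gamma>\<^sub>1 x = None \<and> fmlookup \<Gamma>\<^sub>2 x = Some T))"

text \<open>\<open>\<Gamma>' = \<Gamma> + x : T\<close>\<close>

definition ctx_add :: "ctx \<Rightarrow> name \<Rightarrow> ty \<Rightarrow> ctx \<Rightarrow> bool" where
  "ctx_add \<Gamma> x T \<Gamma>' \<longleftrightarrow>
     (fmlookup \<Gamma> x = None \<and> \<Gamma>' = fmupd x T \<Gamma>) \<or> (fmlookup \<Gamma> x = Some T \<and> un T \<and> \<Gamma>' = \<Gamma>)"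

text \<open>
  Well-formedness of types is required where a rule introduces a new type (\<open>v_sub\<close>, \<open>p_res\<close>) and,
  in \<open>CMV_plus\<close> below, of the initial context; all other types in a derivation inherit it.
\<close>

inductive val_typed :: "ctx \<Rightarrow> name val \<Rightarrow> ty \<Rightarrow> bool" where
  v_unit: "qual_ctx Unr \<Gamma> \<Longrightarrow> val_typed \<Gamma> VUnit TUnit"
| v_true: "qual_ctx Unr \<Gamma> \<Longrightarrow> val_typed \<Gamma> VTrue TBool"
| v_false: "qual_ctx Unr \<Gamma> \<Longrightarrow> val_typed \<Gamma> VFalse TBool"
| v_name: "fmlookup \<Gamma> x = Some T \<Longrightarrow> qual_ctx Unr (fmdrop x \<Gamma>) \<Longrightarrow> val_typed \<Gamma> (Name x) T"
| v_sub: "val_typed \<Gamma> v T \<Longrightarrow> subty T U \<Longrightarrow> wf_ty {} U \<Longrightarrow> val_typed \<Gamma> v U"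

text \<open>
  \<open>branch_typed \<Gamma> M (l, p) (T, U)\<close> types the branch \<open>M\<close> with label \<open>l\<close>, polarity \<open>p\<close>, payload
  type \<open>T\<close> and continuation type \<open>U\<close>.
\<close>

inductive typed :: "ctx \<Rightarrow> 't aproc \<Rightarrow> bool"
  and branch_typed :: "ctx \<Rightarrow> 't abranch \<Rightarrow> label \<times> pol \<Rightarrow> ty \<times> ty \<Rightarrow> bool" where
  p_inert: "qual_ctx Unr \<Gamma> \<Longrightarrow> typed \<Gamma> Inert"
| p_par: "split \<Gamma> \<Gamma>\<^sub>1 \<Gamma>\<^sub>2 \<Longrightarrow> typed \<Gamma>\<^sub>1 P \<Longrightarrow> typed \<Gamma>\<^sub>2 Q \<Longrightarrow> typed \<Gamma> (Par P Q)"
| p_if: "split \<Gamma> \<Gamma>\<^sub>1 \<Gamma>\<^sub>2 \<Longrightarrow> val_typed \<Gamma>\<^sub>1 v TBool \<Longrightarrow> typed \<Gamma>\<^sub>2 P \<Longrightarrow> typed \<Gamma>\<^sub>2 Q \<Longrightarrow>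
    typed \<Gamma> (If t v P Q)"
| p_res: "x \<noteq> y \<Longrightarrow> fmlookup \<Gamma> x = None \<Longrightarrow> fmlookup \<Gamma> y = None \<Longrightarrow>
    wf_ty {} T \<Longrightarrow> wf_ty {} U \<Longrightarrow> dual T U \<Longrightarrow>
    typed (fmupd y U (fmupd x T \<Gamma>)) P \<Longrightarrow> typed \<Gamma> (Res x y P)"
| p_choice: "split \<Gamma> \<Gamma>\<^sub>1 \<Gamma>\<^sub>2 \<Longrightarrow> qual_ctx q\<^sub>1 \<Gamma> \<Longrightarrow> val_typed \<Gamma>\<^sub>1 (Name x) (TChoice q\<^sub>2 w B) \<Longrightarrow>
    branch_key ` set_mset Ms = fmdom' B \<Longrightarrow>
    (\<And>M. M \<in># Ms \<Longrightarrow> \<exists>T U \<Gamma>'. fmlookup B (branch_key M) = Some (T, U) \<and> ctx_add \<Gamma>\<^sub>2 x U \<Gamma>' \<and>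
       branch_typed \<Gamma>' M (branch_key M) (T, U)) \<Longrightarrow>
    typed \<Gamma> (Choice t q\<^sub>1 x Ms)"
| b_out: "split \<Gamma> \<Gamma>\<^sub>1 \<Gamma>\<^sub>2 \<Longrightarrow> val_typed \<Gamma>\<^sub>1 v T \<Longrightarrow> typed \<Gamma>\<^sub>2 P \<Longrightarrow>
    branch_typed \<Gamma> (Out l v P) (l, Snd) (T, U)"
| b_in: "fmlookup \<Gamma> x = None \<Longrightarrow> typed (fmupd x T \<Gamma>) P \<Longrightarrow>
    branch_typed \<Gamma> (In l x P) (l, Rcv) (T, U)"

text \<open>
  Context extension requires fresh names, so a process with clashing bound names is typed via an
  \<open>\<alpha>\<close>-variant.
\<close>

definition CMV_plus :: "process set" where
  "CMV_plus = {P. \<exists>P' \<Gamma>. alpha P P' \<and> wf_ctx \<Gamma> \<and> typed \<Gamma> P'}"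


section \<open>Conflict, distributability and the synchronisation pattern\<close>

text \<open>\<open>A\<close> annotates \<open>P\<close> such that different occurrences have different annotations.\<close>

definition occurrence_annotation :: "nat aproc \<Rightarrow> process \<Rightarrow> bool" where
  "occurrence_annotation A P \<longleftrightarrow> erase A = P \<and> (\<forall>t. count (occs A) t \<le> 1)"

text \<open>A step is given by the occurrences that it reduces and by its target.\<close>

type_synonym step = "nat set \<times> nat aproc"

definition steps :: "nat aproc \<Rightarrow> step set" where
  "steps A = {(ts, A'). red A ts A'}"

definition target :: "step \<Rightarrow> process" where
  "target s = erase (snd s)"

definition in_conflict :: "step \<Rightarrow> step \<Rightarrow> bool" where
  "in_conflict s s' \<longleftrightarrow> fst s \<inter> fst s' \<noteq> {}"

definition distributable :: "step \<Rightarrow> step \<Rightarrow> bool" where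
  "distributable s s' \<longleftrightarrow> \<not> in_conflict s s'"

text \<open>
  Targets are compared syntactically, which is the weakest reading of ``pairwise different'': it
  covers targets that are different up to structural congruence.
\<close>

definition is_star :: "process \<Rightarrow> bool" where
  "is_star P \<longleftrightarrow> (\<exists>A a b c d e. occurrence_annotation A P \<and>
     {a, b, c, d, e} \<subseteq> steps A \<and>
     distinct [target a, target b, target c, target d, target e] \<and>
     in_conflict a b \<and> in_conflict b c \<and> in_conflict c d \<and> in_conflict d e \<and> in_conflict e a \<and>
     distributable a c \<and> distributable a d \<and> distributable b d \<and>
     distributable b e \<and> distributable c e)"

end

theory Submission
  imports Defs
begin

text \<open>
  A communication reduces two choices on opposite endpoints of one channel. Hence the choices can
  be coloured with two colours such that the two choices reduced by a communication always have
  different colours, by colouring the two endpoints of every channel differently. In a \<open>\<star>\<close> the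
  five steps would be the edges of a cycle through five choices, and an odd cycle has no such
  colouring. Typing is used only to exclude a restriction with equal endpoints.
\<close>

text \<open>Choices and conditionals act as leaves: \<open>proper\<close> and
  \<open>coloured\<close> inspect only what is not yet guarded, which is all that a single step can
  reduce.\<close>

lemma proc_active_induct [case_names Choice Par Res If Inert]:
  assumes "\<And>t q y Ms. R (Choice t q y Ms)"
    and "\<And>P Q. R P \<Longrightarrow> R Q \<Longrightarrow> R (Par P Q)"
    and "\<And>y z P. R P \<Longrightarrow> R (Res y z P)"
    and "\<And>t v P Q. R (If t v P Q)"
    and "R Inert"
  shows "R P"
  by (rule proc.induct[of "\<lambda>_. True" R]) (use assms in auto)

primrec proper :: "('n, 't) proc \<Rightarrow> bool" where
  "proper (Choice t q y Ms) \<longleftrightarrow> True"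
| "proper (Par P Q) \<longleftrightarrow> proper P \<and> proper Q"
| "proper (Res y z P) \<longleftrightarrow> y \<noteq> z \<and> proper P"
| "proper (If t v P Q) \<longleftrightarrow> True"
| "proper Inert \<longleftrightarrow> True"

lemma proper_map: "inj f \<Longrightarrow> proper (map_proc f g P) = proper P"
  by (induction P rule: proc_active_induct) (auto simp: inj_eq)

lemma proper_alpha: "alpha P Q \<Longrightarrow> proper P = proper Q"
  unfolding alpha_def
proof (induction rule: congr.induct)
  case (base P Q)
  then show ?case
    by (cases rule: alpha_ax.cases) (auto simp: proper_map)
qed auto

lemma proper_typed: "typed \<Gamma> P \<Longrightarrow> proper P"
proof (induction P arbitrary: \<Gamma> rule: proc_active_induct)
  case (Par P Q)
  from Par.prems Par.IH show ?case by (cases rule: typed.cases) auto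
next
  case (Res y z P)
  from Res.prems Res.IH show ?case by (cases rule: typed.cases) auto
qed auto

text \<open>
  The colour of an endpoint of a restriction is chosen existentially, since structural congruence
  may exchange the endpoints.
\<close>

primrec coloured :: "('t \<Rightarrow> bool) \<Rightarrow> ('n \<Rightarrow> bool) \<Rightarrow> ('n, 't) proc \<Rightarrow> bool" where
  "coloured c \<rho> (Choice t q y Ms) \<longleftrightarrow> c t = \<rho> y"
| "coloured c \<rho> (Par P Q) \<longleftrightarrow> coloured c \<rho> P \<and> coloured c \<rho> Q"
| "coloured c \<rho> (Res y z P) \<longleftrightarrow> y \<noteq> z \<and> (\<exists>b. coloured c (\<rho>(y := b, z := \<not> b)) P)"
| "coloured c \<rho> (If t v P Q) \<longleftrightarrow> True"
| "coloured c \<rho> Inert \<longleftrightarrow> True"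

lemma coloured_cong_names:
  "(\<And>x. x \<in> fn P \<Longrightarrow> \<rho> x = \<rho>' x) \<Longrightarrow> coloured c \<rho> P = coloured c \<rho>' P"
proof (induction P arbitrary: \<rho> \<rho>' rule: proc_active_induct)
  case (Par P Q)
  have "coloured c \<rho> P = coloured c \<rho>' P" "coloured c \<rho> Q = coloured c \<rho>' Q"
    by (rule Par.IH; use Par.prems in simp)+
  then show ?case by simp
next
  case (Res y z P)
  have "coloured c (\<rho>(y := b, z := \<not> b)) P = coloured c (\<rho>'(y := b, z := \<not> b)) P" for b
    by (rule Res.IH) (use Res.prems in auto)
  then show ?case by simp
qed auto

lemma coloured_cong_occs:
  "(\<And>t. t \<in># occs P \<Longrightarrow> c t = c' t) \<Longrightarrow> coloured c \<rho> P = coloured c' \<rho> P"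
  by (induction P arbitrary: \<rho> rule: proc_active_induct) auto

lemma coloured_swap:
  "coloured c \<rho> (swap x y P) = coloured c (\<rho> \<circ> transpose x y) P"
proof (induction P arbitrary: \<rho> rule: proc_active_induct)
  case (Res u v P)
  have "(\<rho>(transpose x y u := b, transpose x y v := b')) \<circ> transpose x y =
      (\<rho> \<circ> transpose x y)(u := b, v := b')" for b b'
    by (auto simp: fun_eq_iff inj_eq[OF bij_is_inj[OF bij_transpose]])
  then show ?case
    by (simp only: proc.map coloured.simps Res.IH inj_eq[OF bij_is_inj[OF bij_transpose]])
qed auto

text \<open>A renamed endpoint inherits the colour of the old one. The two resulting assignments can
  differ only at the new name, which is not free in the body.\<close>

lemma coloured_alpha_ax: "alpha_ax P Q \<Longrightarrow> coloured c \<rho> P = coloured c \<rho> Q"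
proof (induction rule: alpha_ax.induct)
  case (alpha_res1 y z y' P)
  have "coloured c ((\<rho>(y' := b, z := \<not> b)) \<circ> transpose y y') P =
      coloured c (\<rho>(y := b, z := \<not> b)) P" for b
    by (rule coloured_cong_names) (use alpha_res1 in \<open>auto simp: transpose_def\<close>)
  with alpha_res1 show ?case by (simp add: coloured_swap)
next
  case (alpha_res2 y z z' P)
  have "coloured c ((\<rho>(y := b, z' := \<not> b)) \<circ> transpose z z') P =
      coloured c (\<rho>(y := b, z := \<not> b)) P" for b
    by (rule coloured_cong_names) (use alpha_res2 in \<open>auto simp: transpose_def\<close>)
  with alpha_res2 show ?case by (auto simp: coloured_swap)
qed auto

lemma coloured_struct_ax: "struct_ax P Q \<Longrightarrow> coloured c \<rho> P = coloured c \<rho> Q"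
proof (induction rule: struct_ax.induct)
  case (scope y P z Q)
  have "coloured c (\<rho>(y := b, z := \<not> b)) P = coloured c \<rho> P" for b
    by (rule coloured_cong_names) (use scope in auto)
  with scope show ?case by auto
next
  case (res_swap y z P)
  have "\<rho>(y := b, z := b') = \<rho>(z := b', y := b)" if "y \<noteq> z" for b b'
    using that by (rule fun_upd_twist)
  \<comment> \<open>Exchanging the endpoints negates the witness for the existential colour.\<close>
  from this[of True False] this[of False True] show ?case
    by (auto simp: ex_bool_eq)
next
  case (res_res w x y z P)
  have "\<rho>(w := a, x := \<not> a, y := b, z := \<not> b) = \<rho>(y := b, z := \<not> b, w := a, x := \<not> a)" for a b
    using res_res by (auto simp: fun_eq_iff)
  with res_res show ?case by auto
qed auto

lemma coloured_scong: "scong P Q \<Longrightarrow> coloured c \<rho> P = coloured c \<rho> Q"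
  unfolding scong_def
proof (induction arbitrary: \<rho> rule: congr.induct)
  case (base P Q)
  then show ?case by (auto simp: coloured_alpha_ax coloured_struct_ax)
qed auto

text \<open>In \<open>comm\<close> the subjects are the endpoints of one restriction, coloured
  \<open>b\<close> and \<open>\<not> b\<close>. A conditional reduces a single occurrence, so
  nothing is to be shown. Only the source of the step matters.\<close>

lemma red_coloured:
  "red P ts P' \<Longrightarrow> coloured c \<rho> P \<Longrightarrow> s \<in> ts \<Longrightarrow> t \<in> ts \<Longrightarrow> s \<noteq> t \<Longrightarrow> c s \<noteq> c t"
proof (induction arbitrary: \<rho> rule: red.induct)
  case (red_scong P Q ts Q' P')
  then show ?case by (auto simp: coloured_scong)
qed auto

text \<open>Each unguarded choice must take the colour of its subject. As no annotation occurs
  twice, these demands never clash.\<close>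

lemma ex_coloured:
  "proper P \<Longrightarrow> (\<And>t. count (occs P) t \<le> 1) \<Longrightarrow> \<exists>c. coloured c \<rho> P"
proof (induction P arbitrary: \<rho> rule: proc_active_induct)
  case (Choice t q y Ms)
  show ?case by (auto intro: exI[of _ "\<lambda>_. \<rho> y"])
next
  case (Par P Q)
  have le: "count (occs P) t + count (occs Q) t \<le> 1" for t
    using Par.prems(2)[of t] by simp
  have "proper P" "proper Q" using Par.prems(1) by auto
  moreover have "count (occs P) t \<le> 1" "count (occs Q) t \<le> 1" for t
    using le[of t] by linarith+
  ultimately obtain c d where c: "coloured c \<rho> P" and d: "coloured d \<rho> Q"
    using Par.IH by meson
  \<comment> \<open>The two colourings can be glued because \<open>P\<close> and \<open>Q\<close>
    share no annotation.\<close>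
  define e where "e t = (if t \<in># occs P then c t else d t)" for t
  have "t \<notin># occs P" if "t \<in># occs Q" for t
    using le[of t] that by (simp add: not_in_iff flip: count_greater_zero_iff)
  then have "coloured e \<rho> Q = coloured d \<rho> Q"
    by (intro coloured_cong_occs) (auto simp: e_def)
  moreover have "coloured e \<rho> P = coloured c \<rho> P"
    by (rule coloured_cong_occs) (simp add: e_def)
  ultimately show ?case using c d by auto
next
  case (Res y z P)
  then show ?case by simp blast
qed auto

theorem lemma4p5:
  shows "\<not> (\<exists>P \<in> CMV_plus. is_star P)"
proof
  assume "\<exists>P \<in> CMV_plus. is_star P"
  then obtain P P' \<Gamma> where P': "alpha P P'" "typed \<Gamma> P'" and "is_star P"
    by (auto simp: CMV_plus_def)
  then obtain A a b c d e where
    A: "occurrence_annotation A P" and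
    steps: "{a, b, c, d, e} \<subseteq> steps A" and
    conflict: "in_conflict a b" "in_conflict b c" "in_conflict c d" "in_conflict d e"
      "in_conflict e a" and
    distr: "distributable a c" "distributable a d" "distributable b d" "distributable b e"
      "distributable c e"
    unfolding is_star_def by (elim exE conjE) rule
  have A: "erase A = P" "\<And>t. count (occs A) t \<le> 1"
    using A by (auto simp: occurrence_annotation_def)
  \<comment> \<open>Erasure leaves names alone, so \<open>proper\<close> passes from the typed
    \<alpha>-variant back to \<open>A\<close>.\<close>
  have "proper A"
    using proper_map[of id "\<lambda>_. ()" A] proper_alpha[OF P'(1)] proper_typed[OF P'(2)] A(1) by simp
  \<comment> \<open>The colour of free names is arbitrary: a communication uses two endpoints bound
    by a restriction.\<close>
  then obtain col where "coloured col (\<lambda>_. True) A"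
    using ex_coloured A(2) by meson
  then have col: "col s \<noteq> col t"
    if "f \<in> {a, b, c, d, e}" "s \<in> fst f" "t \<in> fst f" "s \<noteq> t" for f s t
    proof -
    have "red A (fst f) (snd f)" using that(1) steps by (auto simp: steps_def)
    from red_coloured[OF this] that show ?thesis using \<open>coloured col _ A\<close> by blast
  qed
  have "\<exists>x. x \<in> fst f \<inter> fst g" if "in_conflict f g" for f g :: step
    using that by (auto simp: in_conflict_def)
  with conflict obtain p q r s u where
    "p \<in> fst a \<inter> fst b" "q \<in> fst b \<inter> fst c" "r \<in> fst c \<inter> fst d"
    "s \<in> fst d \<inter> fst e" "u \<in> fst e \<inter> fst a"
    by metis
  \<comment> \<open>If neighbours coincided, say \<open>p = q\<close>, that occurrence would be
    reduced by both \<open>a\<close> and \<open>c\<close>, which are distributable.\<close>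
  moreover from this have "p \<noteq> q" "q \<noteq> r" "r \<noteq> s" "s \<noteq> u" "u \<noteq> p"
    using distr unfolding distributable_def in_conflict_def by blast+
  ultimately have "col p \<noteq> col q" "col q \<noteq> col r" "col r \<noteq> col s" "col s \<noteq> col u" "col u \<noteq> col p"
    using col[of b p q] col[of c q r] col[of d r s] col[of e s u] col[of a u p] by auto
  then show False by auto
qed

end
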